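(* Let $r\in(0,1]$ and suppose $\Omega\subset\mathbb{C}^d$ is a $\mathbb{C}$-properly convex domain. If $1\le m\le d$ and $$\Omega\cap\mathrm{Span}_{\mathbb{C}}\{e_1,\dots,e_m\}\in\mathbb{K}_m(r)$$ (identifying $\mathrm{Span}_{\mathbb{C}}\{e_1,\dots,e_m\}$ with $\mathbb{C}^m$), then there exists $A\in\mathrm{GL}_d(\mathbb{C})$ such that $A\Omega\in\mathbb{K}_d(r)$ and $A$ restricted to $\mathrm{Span}_{\mathbb{C}}\{e_1,\dots,e_m\}$ is the identity.
   Context: A convex domain in $\mathbb{C}^k$ is $\mathbb{C}$-properly convex if it contains no entire complex affine line. With $e_1,e_2,\dots$ the standard basis vectors and $\mathbb{D}\subset\mathbb{C}$ the open unit disk, for $k\ge1$ and $r\in(0,1]$ the set $\mathbb{K}_k(r)$ consists of the $\mathbb{C}$-properly convex domains $\Omega\subset\mathbb{C}^k$ such that (i) $r\mathbb{D}\cdot e_1\subset\Omega$ and $\mathbb{D}\cdot e_j\subset\Omega$ for $j=2,\dots,k$; and (ii) for every $j=1,\dots,k$, $e_j\in\partial\Omega$ and $(e_j+\mathrm{Span}_{\mathbb{C}}\{e_{j+1},\dots,e_k\})\cap\Omega=\emptyset$. *)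

theory Defs
  imports "HOL-Analysis.Analysis"
begin

text \<open>
  \<open>\<complex>\<^sup>k\<close> is \<open>complex ^ 'n\<close> with \<open>k = CARD('n)\<close>. The linear order on \<open>'n\<close> numbers the
  coordinates from 1 to \<open>k\<close>.
\<close>

definition coord :: "nat \<Rightarrow> 'n::{finite,linorder}" where
  "coord j = sorted_list_of_set UNIV ! (j - 1)"

lemma bij_betw_coord: "bij_betw (coord :: nat \<Rightarrow> 'n::{finite,linorder}) {1..CARD('n)} UNIV"
proof -
  have "bij_betw (\<lambda>i. sorted_list_of_set (UNIV :: 'n set) ! i) {..<CARD('n)} UNIV"
    by (rule bij_betw_nth) auto
  moreover have "bij_betw (\<lambda>j. j - 1) {1..CARD('n)} {..<CARD('n)}"
    by (rule bij_betw_byWitness[where f' = Suc]) auto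
  ultimately have "bij_betw ((\<lambda>i. sorted_list_of_set (UNIV :: 'n set) ! i) \<circ> (\<lambda>j. j - 1))
      {1..CARD('n)} UNIV"
    by (rule bij_betw_trans[rotated])
  thus ?thesis
    by (simp add: coord_def comp_def cong: bij_betw_cong)
qed

definition std_basis :: "nat \<Rightarrow> complex ^ 'n::{finite,linorder}" where
  "std_basis j = axis (coord j) 1"

definition C_properly_convex_domain :: "(complex ^ 'n) set \<Rightarrow> bool" where
  "C_properly_convex_domain \<Omega> \<longleftrightarrow>
     open \<Omega> \<and> connected \<Omega> \<and> \<Omega> \<noteq> {} \<and> convex \<Omega> \<and>
     \<not> (\<exists>a v. v \<noteq> 0 \<and> range (\<lambda>z. a + z *s v) \<subseteq> \<Omega>)"

text \<open>
  \<open>KK r\<close> at type \<open>(complex ^ 'n) set set\<close> is \<open>\<bbbK>\<^sub>k(r)\<close> for \<open>k = CARD('n)\<close>;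
  \<^const>\<open>vec.span\<close> is the complex linear span.
\<close>

definition KK :: "real \<Rightarrow> (complex ^ 'n::{finite,linorder}) set set" where
  "KK r = {\<Omega>. C_properly_convex_domain \<Omega> \<and>
     (\<lambda>z. z *s std_basis 1) ` ball 0 r \<subseteq> \<Omega> \<and>
     (\<forall>j\<in>{2..CARD('n)}. (\<lambda>z. z *s std_basis j) ` ball 0 1 \<subseteq> \<Omega>) \<and>
     (\<forall>j\<in>{1..CARD('n)}. std_basis j \<in> frontier \<Omega> \<and>
        (+) (std_basis j) ` vec.span (std_basis ` {j+1..CARD('n)}) \<inter> \<Omega> = {})}"

text \<open>
  The map \<open>(x\<^sub>1, \<dots>, x\<^sub>m) \<mapsto> x\<^sub>1 e\<^sub>1 + \<dots> + x\<^sub>m e\<^sub>m\<close>, which for \<open>m \<le> d\<close> identifies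
  \<open>\<complex>\<^sup>m\<close> with the span of the first \<open>m\<close> standard basis vectors of \<open>\<complex>\<^sup>d\<close>.
\<close>

definition std_embed :: "complex ^ 'm::{finite,linorder} \<Rightarrow> complex ^ 'd::{finite,linorder}" where
  "std_embed x = (\<Sum>j=1..CARD('m). (x $ coord j) *s std_basis j)"

end

theory Submission
  imports Defs
begin

text \<open>
  For \<open>j \<le> m\<close>, a complex Hahn--Banach argument extends \<open>e\<^sub>j + Span {e\<^sub>j\<^sub>+\<^sub>1, \<dots>, e\<^sub>m}\<close> to a complex
  hyperplane \<open>f\<^sub>j = 1\<close> that misses \<open>\<Omega>\<close>. Further vectors are found one at a time: any line through 0
  in the common kernel of the forms obtained so far leaves \<open>\<Omega>\<close>, its point outside \<open>\<Omega>\<close> nearest to 0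
  is the next vector \<open>v\<close>, and a hyperplane \<open>f = 1\<close> through \<open>v\<close> missing \<open>\<Omega>\<close> gives the next form. Since
  \<open>f\<^sub>i v\<^sub>i = 1\<close> and \<open>f\<^sub>i v\<^sub>l = 0\<close> for \<open>i < l\<close>, the resulting vectors form a basis, and \<open>A\<close> is the map
  taking it to the standard basis.
\<close>

abbreviation complex_linear_form :: "(complex ^ 'n \<Rightarrow> complex) \<Rightarrow> bool" where
  "complex_linear_form \<equiv> Vector_Spaces.linear (*s) (*)"

lemma complex_linear_formI:
  assumes "\<And>x y. f (x + y) = f x + f y" "\<And>c x. f (c *s x) = c * f x"
  shows "complex_linear_form f"
  unfolding Vector_Spaces.linear_iff
  using assms vec.vector_space_axioms vector_space_over_itself.vector_space_axioms by blast

lemma complex_linear_form_add: "complex_linear_form f \<Longrightarrow> f (x + y) = f x + f y"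
  and complex_linear_form_scale: "complex_linear_form f \<Longrightarrow> f (c *s x) = c * f x"
  by (simp_all add: Vector_Spaces.linear_iff)

lemma complex_linear_form_zero: "complex_linear_form f \<Longrightarrow> f 0 = 0"
  by (metis add_cancel_right_left complex_linear_form_add)

lemma complex_linear_form_sum:
  assumes "complex_linear_form f"
  shows "f (sum g S) = (\<Sum>x\<in>S. f (g x))"
  by (induction S rule: infinite_finite_induct)
    (simp_all add: complex_linear_form_zero[OF assms] complex_linear_form_add[OF assms])

lemma scaleR_vec_complex: "c *\<^sub>R x = complex_of_real c *s (x :: complex ^ 'n)"
  by (simp add: vec_eq_iff scaleR_conv_of_real[where 'a = complex])

lemma complex_separation:
  fixes \<Omega> S :: "(complex ^ 'n) set"
  assumes "open \<Omega>" "convex \<Omega>" "0 \<in> \<Omega>" and S: "vec.subspace S"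
    and disj: "(+) v ` S \<inter> \<Omega> = {}"
  obtains f where "complex_linear_form f" "f v = 1" "\<And>s. s \<in> S \<Longrightarrow> f s = 0"
    "\<And>x. x \<in> \<Omega> \<Longrightarrow> f x \<noteq> 1"
proof -
  have "subspace S"
    using S unfolding vec.subspace_def subspace_def scaleR_vec_complex by blast
  then have "convex ((+) v ` S)"
    by (simp add: convex_translation subspace_imp_convex)
  moreover have "0 \<in> S" using S by (simp add: vec.subspace_0)
  ultimately obtain a b where a: "a \<noteq> 0" "\<And>x. x \<in> \<Omega> \<Longrightarrow> inner a x \<le> b"
      "\<And>y. y \<in> (+) v ` S \<Longrightarrow> inner a y \<ge> b"
    using separating_hyperplane_sets[OF \<open>convex \<Omega>\<close>, of "(+) v ` S"] assms by blast
  have strict: "inner a x < b" if x: "x \<in> \<Omega>" for x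
  proof -
    obtain e where e: "e > 0" "cball x e \<subseteq> \<Omega>"
      using \<open>open \<Omega>\<close> x open_contains_cball by blast
    have "x + (e / norm a) *\<^sub>R a \<in> cball x e"
      using e a(1) by (simp add: dist_norm)
    then have "inner a (x + (e / norm a) *\<^sub>R a) \<le> b" using e a(2) by blast
    moreover have "inner a ((e / norm a) *\<^sub>R a) > 0"
      using e a(1) by simp
    ultimately show ?thesis by (simp add: inner_add_right)
  qed
  define h where "h x = (\<Sum>i\<in>UNIV. cnj (a $ i) * x $ i)" for x :: "complex ^ 'n"
  have h: "complex_linear_form h"
    by (rule complex_linear_formI)
      (simp_all add: h_def algebra_simps sum.distrib sum_distrib_left)
  have Re_h: "Re (h x) = inner a x" for x
    by (simp add: h_def inner_vec_def inner_complex_def)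
  have inner_S: "inner a s = 0" if "s \<in> S" for s
  proof (rule ccontr)
    assume ne: "inner a s \<noteq> 0"
    define t where "t = (b - 1 - inner a v) / inner a s"
    have "t *\<^sub>R s \<in> S" using \<open>subspace S\<close> that by (simp add: subspace_scale)
    then have "inner a (v + t *\<^sub>R s) \<ge> b" using a(3) by blast
    then show False using ne by (simp add: inner_add_right t_def)
  qed
  have h_S: "h s = 0" if "s \<in> S" for s
  proof -
    have "\<i> *s s \<in> S" using S that by (simp add: vec.subspace_scale)
    then have "Re (h (\<i> *s s)) = 0" using Re_h inner_S by metis
    then show ?thesis
      using inner_S[OF that] Re_h[of s] complex_linear_form_scale[OF h]
      by (simp add: complex_eq_iff)
  qed
  have b_v: "b \<le> inner a v" using a(3)[of v] \<open>0 \<in> S\<close> by force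
  have "0 < inner a v" using strict[OF \<open>0 \<in> \<Omega>\<close>] b_v by simp
  then have hv: "h v \<noteq> 0" using Re_h[of v] by force
  show thesis
  proof (rule that)
    show "complex_linear_form (\<lambda>x. h x / h v)"
      by (rule complex_linear_formI)
        (simp_all add: complex_linear_form_add[OF h] complex_linear_form_scale[OF h] add_divide_distrib)
    show "h x / h v \<noteq> 1" if "x \<in> \<Omega>" for x
      using strict[OF that] b_v Re_h[of x] Re_h[of v] hv by auto
  qed (use hv h_S in auto)
qed

lemma coord_eq_iff:
  assumes "i \<in> {1..CARD('n)}" "j \<in> {1..CARD('n)}"
  shows "(coord i :: 'n::{finite,linorder}) = coord j \<longleftrightarrow> i = j"
  using assms bij_betw_coord[where 'n = 'n] unfolding bij_betw_def by (auto dest: inj_onD)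

lemma std_basis_nth_coord:
  assumes "i \<in> {1..CARD('n)}" "j \<in> {1..CARD('n)}"
  shows "(std_basis j :: complex ^ 'n::{finite,linorder}) $ coord i = (if i = j then 1 else 0)"
  using coord_eq_iff[OF assms] by (simp add: std_basis_def axis_def)

lemma vec_eq_coordI:
  fixes x y :: "complex ^ 'n::{finite,linorder}"
  assumes "\<And>i. i \<in> {1..CARD('n)} \<Longrightarrow> x $ coord i = y $ coord i"
  shows "x = y"
proof -
  have "x $ c = y $ c" for c
    using assms bij_betw_coord[where 'n = 'n] unfolding bij_betw_def by (metis UNIV_I imageE)
  then show ?thesis by (simp add: vec_eq_iff)
qed

lemma sum_std_basis_nth_coord:
  assumes "k \<le> CARD('n)" "i \<in> {1..CARD('n)}"
  shows "(\<Sum>j=1..k. c j *s (std_basis j :: complex ^ 'n::{finite,linorder})) $ coord i =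
    (if i \<le> k then c i else 0)"
proof -
  have "(\<Sum>j=1..k. c j *s (std_basis j :: (complex, 'n) vec)) $ coord i =
      (\<Sum>j=1..k. if j = i then c j else 0)"
    unfolding sum_component using assms
    by (intro sum.cong refl) (simp add: std_basis_nth_coord)
  then show ?thesis using assms by simp
qed

lemma common_kernel:
  fixes f :: "nat \<Rightarrow> complex ^ 'n::{finite,linorder} \<Rightarrow> complex"
  assumes lin: "\<And>j. j \<in> {1..k} \<Longrightarrow> complex_linear_form (f j)" and k: "k < CARD('n)"
  obtains u where "u \<noteq> 0" "\<And>j. j \<in> {1..k} \<Longrightarrow> f j u = 0"
proof -
  define g :: "(complex, 'n) vec \<Rightarrow> (complex, 'n) vec" where "g x = (\<Sum>j=1..k. f j x *s std_basis j)" for x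
  have g_nth: "g x $ coord i = (if i \<le> k then f i x else 0)" if "i \<in> {1..CARD('n)}" for x i
    unfolding g_def using k that by (intro sum_std_basis_nth_coord) auto
  have g: "Vector_Spaces.linear (*s) (*s) g"
    unfolding Vector_Spaces.linear_iff using vec.vector_space_axioms lin
    by (auto intro!: vec_eq_coordI simp: g_nth complex_linear_form_add complex_linear_form_scale)
  have "\<not> surj g"
  proof
    assume "surj g"
    then obtain x where x: "g x = std_basis (Suc k)" by (metis surjD)
    show False
      using g_nth[of "Suc k" x] std_basis_nth_coord[of "Suc k" "Suc k", where 'n = 'n] k
      by (simp add: x)
  qed
  then have "\<not> inj g" using vec.linear_injective_imp_surjective[OF g] by auto
  then obtain u where u: "u \<noteq> 0" "g u = 0" using vec.linear_inj_iff_eq_0[OF g] by blast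
  show thesis
    by (rule that[OF u(1)]) (use g_nth[of _ u] u(2) k in force)
qed

lemma continuous_on_scale_vec: "continuous_on UNIV (\<lambda>z :: complex. z *s (u :: complex ^ 'n))"
  unfolding vector_scalar_mult_def by (intro continuous_intros continuous_on_vec_lambda)

lemma nearest_exit_point:
  fixes \<Omega> :: "(complex ^ 'n) set"
  assumes "open \<Omega>" "0 \<in> \<Omega>" and line: "\<not> range (\<lambda>z. z *s u) \<subseteq> \<Omega>"
  obtains c where "c *s u \<notin> \<Omega>" "(\<lambda>z. z *s (c *s u)) ` ball 0 1 \<subseteq> \<Omega>"
proof -
  have "open ((\<lambda>z :: complex. z *s u) -` \<Omega>)"
    using continuous_on_open_vimage[of UNIV "\<lambda>z :: complex. z *s u"] continuous_on_scale_vec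
      \<open>open \<Omega>\<close> by auto
  then have "closed (- ((\<lambda>z :: complex. z *s u) -` \<Omega>))" by auto
  moreover have "- ((\<lambda>z :: complex. z *s u) -` \<Omega>) \<noteq> {}" using line by auto
  ultimately obtain c where c: "c *s u \<notin> \<Omega>" "\<And>y. y *s u \<notin> \<Omega> \<Longrightarrow> norm c \<le> norm y"
    using distance_attains_inf[of "- ((\<lambda>z :: complex. z *s u) -` \<Omega>)" 0] by auto
  have "c \<noteq> 0" using c(1) \<open>0 \<in> \<Omega>\<close> by auto
  show thesis
  proof (rule that[OF c(1)], safe)
    fix z :: complex assume "z \<in> ball 0 1"
    then have "norm (z * c) < norm c" using \<open>c \<noteq> 0\<close> by (simp add: norm_mult)
    then have "(z * c) *s u \<in> \<Omega>" using c(2)[of "z * c"] by force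
    then show "z *s (c *s u) \<in> \<Omega>" by simp
  qed
qed

lemma mem_closure_if_disc:
  fixes \<Omega> :: "(complex ^ 'n) set"
  assumes "(\<lambda>z. z *s v) ` ball 0 1 \<subseteq> \<Omega>"
  shows "v \<in> closure \<Omega>"
proof -
  have "(\<lambda>z. z *s v) ` closure (ball 0 1) \<subseteq> closure \<Omega>"
    using assms closure_mono
    by (intro image_closure_subset[OF continuous_on_subset[OF continuous_on_scale_vec]])
      (auto intro: closure_subset[THEN subsetD])
  moreover have "(1 :: complex) \<in> closure (ball 0 1)" by simp
  ultimately have "1 *s v \<in> closure \<Omega>" by blast
  then show ?thesis by simp
qed

definition supporting_system ::
    "(complex ^ 'n) set \<Rightarrow> nat \<Rightarrow> (nat \<Rightarrow> complex ^ 'n) \<Rightarrow> (nat \<Rightarrow> complex ^ 'n \<Rightarrow> complex) \<Rightarrow> bool"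
  where "supporting_system \<Omega> k v f \<longleftrightarrow>
    (\<forall>i\<in>{1..k}. complex_linear_form (f i) \<and> f i (v i) = 1 \<and> (\<forall>l\<in>{i+1..k}. f i (v l) = 0) \<and>
       (\<forall>x\<in>\<Omega>. f i x \<noteq> 1) \<and> v i \<in> closure \<Omega>)"

lemma extend_supporting_system:
  fixes \<Omega> :: "(complex ^ 'n::{finite,linorder}) set"
  assumes \<Omega>: "C_properly_convex_domain \<Omega>" "0 \<in> \<Omega>"
    and v: "supporting_system \<Omega> m v f" and "m \<le> k" "k \<le> CARD('n)"
  shows "\<exists>v' f'. supporting_system \<Omega> k v' f' \<and> (\<forall>i\<in>{1..m}. v' i = v i) \<and>
    (\<forall>i\<in>{m+1..k}. (\<lambda>z. z *s v' i) ` ball 0 1 \<subseteq> \<Omega>)"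
  using \<open>m \<le> k\<close> \<open>k \<le> CARD('n)\<close>
proof (induction k rule: dec_induct)
  case base
  then show ?case using v by auto
next
  case (step k)
  then obtain w g where w: "supporting_system \<Omega> k w g" "\<forall>i\<in>{1..m}. w i = v i"
      "\<forall>i\<in>{m+1..k}. (\<lambda>z. z *s w i) ` ball 0 1 \<subseteq> \<Omega>"
    by auto
  have op: "open \<Omega>" "convex \<Omega>" using \<Omega> by (auto simp: C_properly_convex_domain_def)
  obtain u where u: "u \<noteq> 0" "\<And>j. j \<in> {1..k} \<Longrightarrow> g j u = 0"
    using common_kernel[of k g] w(1) step.prems unfolding supporting_system_def
    by (metis Suc_le_lessD)
  have "\<not> range (\<lambda>z. 0 + z *s u) \<subseteq> \<Omega>"
    using \<Omega>(1) u(1) unfolding C_properly_convex_domain_def by blast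
  then obtain c where c: "c *s u \<notin> \<Omega>" "(\<lambda>z. z *s (c *s u)) ` ball 0 1 \<subseteq> \<Omega>"
    using nearest_exit_point[OF op(1) \<Omega>(2), of u] by auto
  have "(+) (c *s u) ` {0} \<inter> \<Omega> = {}" using c(1) by simp
  then obtain h where h: "complex_linear_form h" "h (c *s u) = 1" "\<And>x. x \<in> \<Omega> \<Longrightarrow> h x \<noteq> 1"
    using complex_separation[OF op \<Omega>(2) vec.subspace_single_0] by metis
  have g_u: "g i (c *s u) = 0" if "i \<in> {1..k}" for i
    using w(1) u(2)[OF that] that complex_linear_form_scale
    unfolding supporting_system_def by fastforce
  have "supporting_system \<Omega> (Suc k) (w(Suc k := c *s u)) (g(Suc k := h))"
    using w(1) g_u h mem_closure_if_disc[OF c(2)]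
    unfolding supporting_system_def by (auto simp: le_Suc_eq)
  moreover have "\<forall>i\<in>{1..m}. (w(Suc k := c *s u)) i = v i"
    using w(2) step.hyps by auto
  moreover have "\<forall>i\<in>{m+1..Suc k}. (\<lambda>z. z *s (w(Suc k := c *s u)) i) ` ball 0 1 \<subseteq> \<Omega>"
  proof
    fix i assume i: "i \<in> {m+1..Suc k}"
    show "(\<lambda>z. z *s (w(Suc k := c *s u)) i) ` ball 0 1 \<subseteq> \<Omega>"
    proof (cases "i = Suc k")
      case True
      then show ?thesis using c(2) by (simp only: fun_upd_same)
    next
      case False
      then have "i \<in> {m+1..k}" using i by auto
      then have "(\<lambda>z. z *s w i) ` ball 0 1 \<subseteq> \<Omega>" using w(3) by blast
      then show ?thesis using False by (simp only: fun_upd_other simp_thms)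
    qed
  qed
  ultimately show ?case by blast
qed

lemma linear_std_embed:
  "Vector_Spaces.linear (*s) (*s)
    (std_embed :: complex ^ 'm::{finite,linorder} \<Rightarrow> complex ^ 'd::{finite,linorder})"
  unfolding Vector_Spaces.linear_iff std_embed_def
  by (simp add: vec.vector_space_axioms vec.scale_left_distrib sum.distrib vec.scale_sum_right)

lemma std_embed_std_basis:
  assumes "CARD('m) \<le> CARD('d)" "j \<in> {1..CARD('m)}"
  shows "std_embed (std_basis j :: complex ^ 'm::{finite,linorder}) =
    (std_basis j :: complex ^ 'd::{finite,linorder})"
proof (rule vec_eq_coordI)
  fix i assume i: "i \<in> {1..CARD('d)}"
  let ?x = "std_embed (std_basis j :: (complex, 'm) vec) :: (complex, 'd) vec"
  have "?x $ coord i = (if i \<le> CARD('m) then (std_basis j :: (complex, 'm) vec) $ coord i else 0)"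
    unfolding std_embed_def by (rule sum_std_basis_nth_coord[OF assms(1) i])
  moreover have "j \<in> {1..CARD('d)}" using assms by auto
  ultimately show "?x $ coord i = (std_basis j :: (complex, 'd) vec) $ coord i"
    using i assms(2) by (cases "i \<le> CARD('m)") (simp_all add: std_basis_nth_coord)
qed

lemma supporting_form_of_section:
  fixes \<Omega> :: "(complex ^ 'd::{finite,linorder}) set"
    and \<Omega>\<^sub>m :: "(complex ^ 'm::{finite,linorder}) set"
  assumes \<Omega>: "open \<Omega>" "convex \<Omega>" "0 \<in> \<Omega>" and dim: "CARD('m) \<le> CARD('d)"
    and \<Omega>\<^sub>m: "\<Omega>\<^sub>m = std_embed -` (\<Omega> \<inter> vec.span (std_basis ` {1..CARD('m)}))"
    and j: "j \<in> {1..CARD('m)}"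
    and disj: "(+) (std_basis j) ` vec.span (std_basis ` {j+1..CARD('m)}) \<inter> \<Omega>\<^sub>m = {}"
  obtains f where "complex_linear_form f" "f (std_basis j) = 1"
    "\<And>l. l \<in> {j+1..CARD('m)} \<Longrightarrow> f (std_basis l) = 0" "\<And>x. x \<in> \<Omega> \<Longrightarrow> f x \<noteq> 1"
proof -
  let ?E = "std_embed :: (complex, 'm) vec \<Rightarrow> (complex, 'd) vec"
  let ?S = "vec.span (std_basis ` {j+1..CARD('m)}) :: ((complex, 'd) vec) set"
  have image: "?E ` vec.span (std_basis ` {i..CARD('m)}) = vec.span (std_basis ` {i..CARD('m)})"
    if "i \<ge> 1" for i
    unfolding vec.linear_span_image[OF linear_std_embed, symmetric] image_image using that
    by (intro arg_cong[where f = vec.span] image_cong) (auto simp: std_embed_std_basis[OF dim])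
  have "(+) (std_basis j) ` ?S \<inter> \<Omega> = {}"
  proof (rule ccontr)
    assume "(+) (std_basis j) ` ?S \<inter> \<Omega> \<noteq> {}"
    then obtain s where s: "s \<in> ?S" "std_basis j + s \<in> \<Omega>" by auto
    then obtain s' where s': "s' \<in> vec.span (std_basis ` {j+1..CARD('m)})" "s = ?E s'"
      using image[of "j + 1"] by auto
    have eq: "?E (std_basis j + s') = std_basis j + s"
      using s'(2) j by (simp add: vec.linear_add[OF linear_std_embed] std_embed_std_basis[OF dim])
    have "s \<in> vec.span (std_basis ` {1..CARD('m)})"
      using s(1) vec.span_mono[of "std_basis ` {j+1..CARD('m)}" "std_basis ` {1..CARD('m)}"]
      by fastforce
    then have "std_basis j + s \<in> vec.span (std_basis ` {1..CARD('m)})"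
      using j by (intro vec.span_add) (auto intro: vec.span_base)
    then have "std_basis j + s' \<in> \<Omega>\<^sub>m" using eq s(2) \<Omega>\<^sub>m by simp
    then show False using disj s'(1) by blast
  qed
  then obtain f where f: "complex_linear_form f" "f (std_basis j) = 1"
      "\<And>s. s \<in> ?S \<Longrightarrow> f s = 0" "\<And>x. x \<in> \<Omega> \<Longrightarrow> f x \<noteq> 1"
    using complex_separation[OF \<Omega> vec.subspace_span] by metis
  then show thesis by (intro that[OF f(1,2) f(3)]) (auto intro: vec.span_base)
qed

lemma std_basis_in_closure_of_section:
  fixes \<Omega> :: "(complex ^ 'd::{finite,linorder}) set"
    and \<Omega>\<^sub>m :: "(complex ^ 'm::{finite,linorder}) set"
  assumes "CARD('m) \<le> CARD('d)" "j \<in> {1..CARD('m)}" "\<Omega>\<^sub>m \<subseteq> std_embed -` \<Omega>"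
    and "std_basis j \<in> closure \<Omega>\<^sub>m"
  shows "std_basis j \<in> closure \<Omega>"
proof -
  have "linear (std_embed :: (complex, 'm) vec \<Rightarrow> (complex, 'd) vec)"
    by (rule linearI) (simp_all add: scaleR_vec_complex
        vec.linear_add[OF linear_std_embed] vec.linear_scale[OF linear_std_embed])
  then have "std_embed ` closure \<Omega>\<^sub>m \<subseteq> closure \<Omega>"
    using assms(3) closure_subset
    by (intro image_closure_subset linear_continuous_on linear_linear[THEN iffD2]) auto
  then show ?thesis using assms(4) std_embed_std_basis[OF assms(1,2)] by force
qed

lemma triangular_matrix:
  fixes \<Omega> :: "(complex ^ 'd::{finite,linorder}) set"
  assumes v: "supporting_system \<Omega> CARD('d) v f"
  obtains B :: "complex ^ 'd::{finite,linorder} ^ 'd::{finite,linorder}" where "invertible B"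
    "\<And>j. j \<in> {1..CARD('d)} \<Longrightarrow> B *v std_basis j = v j"
proof -
  define T :: "(complex, 'd) vec \<Rightarrow> (complex, 'd) vec" where "T x = (\<Sum>j=1..CARD('d). x $ coord j *s v j)" for x
  have T: "Vector_Spaces.linear (*s) (*s) T"
    unfolding Vector_Spaces.linear_iff T_def using vec.vector_space_axioms
    by (simp add: vec.scale_left_distrib sum.distrib vec.scale_sum_right)
  have T_basis: "T (std_basis j) = v j" if "j \<in> {1..CARD('d)}" for j
  proof -
    have "T (std_basis j) = (\<Sum>i=1..CARD('d). if i = j then v i else 0)"
      unfolding T_def using that by (intro sum.cong refl) (simp add: std_basis_nth_coord)
    then show ?thesis using that by simp
  qed
  have "x = 0" if x: "T x = 0" for x
  proof (rule vec_eq_coordI)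
    fix i assume "i \<in> {1..CARD('d)}"
    then show "x $ coord i = 0 $ coord i"
    proof (induction i rule: less_induct)
      case (less i)
      have f: "complex_linear_form (f i)" "f i (v i) = 1" "\<forall>l\<in>{i+1..CARD('d)}. f i (v l) = 0"
        using v less.prems by (auto simp: supporting_system_def)
      have "x $ coord j * f i (v j) = (if j = i then x $ coord i else 0)"
        if "j \<in> {1..CARD('d)}" for j
        using that less.IH[of j] f(2,3) by (cases j i rule: linorder_cases) auto
      then have "(\<Sum>j=1..CARD('d). x $ coord j * f i (v j)) =
          (\<Sum>j=1..CARD('d). if j = i then x $ coord i else 0)"
        by (intro sum.cong) auto
      moreover have "f i (T x) = 0" using x complex_linear_form_zero[OF f(1)] by simp
      ultimately show ?case using less.prems
        by (simp add: T_def complex_linear_form_sum[OF f(1)] complex_linear_form_scale[OF f(1)])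
    qed
  qed
  then have "invertible (matrix T)"
    unfolding invertible_left_inverse matrix_left_invertible_ker using matrix_works[OF T] by metis
  then show thesis by (rule that) (simp add: matrix_works[OF T] T_basis)
qed

lemma C_properly_convex_domain_image:
  fixes \<Omega> :: "(complex ^ 'd) set" and A B :: "complex ^ 'd ^ 'd"
  assumes \<Omega>: "C_properly_convex_domain \<Omega>" and AB: "A ** B = mat 1" "B ** A = mat 1"
  shows "C_properly_convex_domain ((*v) A ` \<Omega>)"
proof -
  have inv: "A *v (B *v x) = x" "B *v (A *v x) = x" for x
    by (simp_all add: matrix_vector_mul_assoc AB)
  have image: "(*v) A ` \<Omega> = (*v) B -` \<Omega>" by (auto simp: inv intro: rev_image_eqI)
  have "linear ((*v) A)" "linear ((*v) B)" by auto
  then have "continuous_on UNIV ((*v) B)"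
    by (simp add: linear_continuous_on linear_linear)
  then have "open ((*v) A ` \<Omega>)"
    unfolding image using \<Omega> continuous_on_open_vimage[of UNIV "(*v) B"]
    by (auto simp: C_properly_convex_domain_def)
  moreover have cx: "convex ((*v) A ` \<Omega>)"
    using \<Omega> \<open>linear ((*v) A)\<close> convex_linear_image by (auto simp: C_properly_convex_domain_def)
  moreover have "\<not> range (\<lambda>z. a + z *s v) \<subseteq> (*v) A ` \<Omega>" if "v \<noteq> 0" for a v
  proof
    assume "range (\<lambda>z. a + z *s v) \<subseteq> (*v) A ` \<Omega>"
    then have "range (\<lambda>z. B *v a + z *s (B *v v)) \<subseteq> \<Omega>"
      unfolding image by (auto simp: vec.add vec.scale)
    moreover have "B *v v \<noteq> 0" using inv(1)[of v] that by auto
    ultimately show False using \<Omega> unfolding C_properly_convex_domain_def by blast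
  qed
  ultimately show ?thesis
    using \<Omega> convex_connected[OF cx] by (auto simp: C_properly_convex_domain_def)
qed

theorem proposition4p6:
  fixes r :: real
    and \<Omega> :: "(complex ^ 'd::{finite,linorder}) set"
    and \<Omega>\<^sub>m :: "(complex ^ 'm::{finite,linorder}) set"
  assumes "r \<in> {0<..1}"
    and "C_properly_convex_domain \<Omega>"
    and "CARD('m) \<le> CARD('d)"
    and "\<Omega>\<^sub>m = std_embed -` (\<Omega> \<inter> vec.span (std_basis ` {1..CARD('m)}))"
    and "\<Omega>\<^sub>m \<in> KK r"
  shows "\<exists>A :: complex ^ 'd::{finite,linorder} ^ 'd::{finite,linorder}. invertible A \<and> (*v) A ` \<Omega> \<in> KK r \<and>
           (\<forall>x \<in> vec.span (std_basis ` {1..CARD('m)}). A *v x = x)"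
proof -
  let ?e = "std_basis :: nat \<Rightarrow> (complex, 'd) vec"
  let ?m = "CARD('m)"
  let ?d = "CARD('d)"
  have m: "?m \<ge> 1" by (simp add: Suc_le_eq)
  have disc_r: "(\<lambda>z. z *s std_basis 1) ` ball 0 r \<subseteq> \<Omega>\<^sub>m"
    and disc: "\<And>j. j \<in> {2..?m} \<Longrightarrow> (\<lambda>z. z *s std_basis j) ` ball 0 1 \<subseteq> \<Omega>\<^sub>m"
    and frontier: "\<And>j. j \<in> {1..?m} \<Longrightarrow> std_basis j \<in> frontier \<Omega>\<^sub>m"
    and disj: "\<And>j. j \<in> {1..?m} \<Longrightarrow>
      (+) (std_basis j) ` vec.span (std_basis ` {j+1..?m}) \<inter> \<Omega>\<^sub>m = {}"
    using assms(5) unfolding KK_def by auto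
  have \<Omega>\<^sub>m_sub: "\<Omega>\<^sub>m \<subseteq> std_embed -` \<Omega>" using assms(4) by auto
  have embed_disc: "(\<lambda>z. z *s ?e j) ` ball 0 s \<subseteq> \<Omega>"
    if "j \<in> {1..?m}" "(\<lambda>z. z *s std_basis j) ` ball 0 s \<subseteq> \<Omega>\<^sub>m" for j s
    using that \<Omega>\<^sub>m_sub std_embed_std_basis[OF assms(3) that(1)]
    by (fastforce simp: vec.linear_scale[OF linear_std_embed])
  have disc_r': "(\<lambda>z. z *s ?e 1) ` ball 0 r \<subseteq> \<Omega>" using embed_disc[OF _ disc_r] m by simp
  then have "0 *s ?e 1 \<in> \<Omega>" using assms(1) by (metis centre_in_ball greaterThanAtMost_iff image_subset_iff)
  then have zero: "0 \<in> \<Omega>" by simp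
  have op: "open \<Omega>" "convex \<Omega>" using assms(2) by (auto simp: C_properly_convex_domain_def)
  have "\<exists>f. complex_linear_form f \<and> f (?e j) = 1 \<and> (\<forall>l\<in>{j+1..?m}. f (?e l) = 0) \<and> (\<forall>x\<in>\<Omega>. f x \<noteq> 1)"
    if "j \<in> {1..?m}" for j
    using supporting_form_of_section[OF op zero assms(3,4) that disj[OF that]] by metis
  then obtain f0 where f0: "\<And>j. j \<in> {1..?m} \<Longrightarrow> complex_linear_form (f0 j) \<and> f0 j (?e j) = 1 \<and>
      (\<forall>l\<in>{j+1..?m}. f0 j (?e l) = 0) \<and> (\<forall>x\<in>\<Omega>. f0 j x \<noteq> 1)"
    by metis
  moreover have "?e j \<in> closure \<Omega>" if "j \<in> {1..?m}" for j
    using std_basis_in_closure_of_section[OF assms(3) that \<Omega>\<^sub>m_sub] frontier[OF that]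
    by (simp add: frontier_def)
  ultimately have "supporting_system \<Omega> ?m ?e f0" by (auto simp: supporting_system_def)
  then obtain v f where v: "supporting_system \<Omega> ?d v f" "\<And>i. i \<in> {1..?m} \<Longrightarrow> v i = ?e i"
      "\<And>i. i \<in> {?m+1..?d} \<Longrightarrow> (\<lambda>z. z *s v i) ` ball 0 1 \<subseteq> \<Omega>"
    using extend_supporting_system[OF assms(2) zero _ assms(3) order.refl] by metis
  obtain B :: "((complex, 'd) vec, 'd) vec" where "invertible B"
    and B: "\<And>j. j \<in> {1..?d} \<Longrightarrow> B *v ?e j = v j"
    using triangular_matrix[OF v(1)] by blast
  then obtain A where AB: "A ** B = mat 1" "B ** A = mat 1" unfolding invertible_def by blast
  have inv: "A *v (B *v x) = x" "B *v (A *v x) = x" for x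
    by (simp_all add: matrix_vector_mul_assoc AB)
  have A: "A *v v j = ?e j" if "j \<in> {1..?d}" for j using inv(1) B[OF that] by metis
  have A_disc: "(\<lambda>z. z *s ?e j) ` ball 0 s \<subseteq> (*v) A ` \<Omega>"
    if "(\<lambda>z. z *s v j) ` ball 0 s \<subseteq> \<Omega>" "j \<in> {1..?d}" for j s
  proof safe
    fix z :: complex assume "z \<in> ball 0 s"
    then have "z *s v j \<in> \<Omega>" using that(1) by blast
    moreover have "z *s ?e j = A *v (z *s v j)" using A[OF that(2)] by (simp add: vec.scale)
    ultimately show "z *s ?e j \<in> (*v) A ` \<Omega>" by blast
  qed
  have disj': "(+) (?e j) ` vec.span (?e ` {j+1..?d}) \<inter> (*v) A ` \<Omega> = {}" if j: "j \<in> {1..?d}" for j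
  proof (rule ccontr)
    assume "(+) (?e j) ` vec.span (?e ` {j+1..?d}) \<inter> (*v) A ` \<Omega> \<noteq> {}"
    then obtain s y where s: "s \<in> vec.span (?e ` {j+1..?d})" "y \<in> \<Omega>" "?e j + s = A *v y" by blast
    have f: "complex_linear_form (f j)" "f j (v j) = 1" "\<forall>l\<in>{j+1..?d}. f j (v l) = 0" "f j y \<noteq> 1"
      using v(1) j s(2) by (auto simp: supporting_system_def)
    have "f j (B *v s) = 0"
      using s(1)
    proof (induction rule: vec.span_induct_alt)
      case (step c x s)
      then show ?case using f B
        by (auto simp: vec.add vec.scale complex_linear_form_add complex_linear_form_scale)
    qed (simp add: complex_linear_form_zero[OF f(1)])
    moreover have "y = v j + B *v s" using arg_cong[OF s(3), of "(*v) B"] inv(2)[of y] B[OF j]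
      by (simp add: vec.add)
    ultimately show False using f by (simp add: complex_linear_form_add)
  qed
  have "?e j \<in> frontier ((*v) A ` \<Omega>)" if j: "j \<in> {1..?d}" for j
  proof -
    have "(*v) A ` closure \<Omega> \<subseteq> closure ((*v) A ` \<Omega>)"
      by (intro image_closure_subset linear_continuous_on linear_linear[THEN iffD2])
        (auto intro: closure_subset[THEN subsetD])
    moreover have "v j \<in> closure \<Omega>" using v(1) j by (auto simp: supporting_system_def)
    ultimately have "?e j \<in> closure ((*v) A ` \<Omega>)" using A[OF j] by force
    moreover have "?e j \<notin> (*v) A ` \<Omega>" using disj'[OF j] vec.span_zero by fastforce
    ultimately show ?thesis unfolding frontier_def using interior_subset by blast
  qed
  moreover have "(\<lambda>z. z *s ?e 1) ` ball 0 r \<subseteq> (*v) A ` \<Omega>"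
    using A_disc[of 1 r] disc_r' v(2)[of 1] m assms(3) by simp
  moreover have "(\<lambda>z. z *s ?e j) ` ball 0 1 \<subseteq> (*v) A ` \<Omega>" if j: "j \<in> {2..?d}" for j
  proof (rule A_disc)
    show "(\<lambda>z. z *s v j) ` ball 0 1 \<subseteq> \<Omega>"
      using embed_disc[OF _ disc, of j] v(2,3)[of j] j by (cases "j \<le> ?m") auto
  qed (use j in auto)
  ultimately have "(*v) A ` \<Omega> \<in> KK r"
    using C_properly_convex_domain_image[OF assms(2) AB] disj' unfolding KK_def by blast
  moreover have "A *v x = x" if "x \<in> vec.span (?e ` {1..?m})" for x
    using that
  proof (induction rule: vec.span_induct_alt)
    case (step c x y)
    then show ?case using A v(2) assms(3) by (force simp: vec.add vec.scale)
  qed simp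
  moreover have "invertible A" using AB unfolding invertible_def by blast
  ultimately show ?thesis by blast
qed

end
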